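(* Let $M$ be a positive integer congruent to $1$ or $4$ modulo $5$, and let $n\ge 1$ and $k\ge 0$ be integers. Then the number of partitions of $n$ into parts congruent to $1$ or $4$ modulo $5$ in which the part $M$ occurs exactly $k$ times is equal to the number of partitions $\lambda=(\lambda_1\ge\lambda_2\ge\cdots)$ of $n$ with difference at least $2$ satisfying: (1) if $\lambda$ has exactly one part, then $\lfloor n/M\rfloor=k$; (2) if $\lambda$ has at least two parts, then $\lfloor(\lambda_1-\lambda_2-2)/M\rfloor=k$.
   Context: A partition $\lambda=(\lambda_1\ge\lambda_2\ge\cdots\ge\lambda_\ell\ge 1)$ has "difference at least $2$" if $\lambda_i-\lambda_{i+1}\ge 2$ for all $1\le i<\ell$ (a one-part partition satisfies this vacuously). *)

theory Defs
  imports Complex_Main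
begin

text \<open>The entry \<open>xs ! i\<close> (indices start at 0) is the part with index \<open>i + 1\<close>.\<close>

definition partitions :: "nat \<Rightarrow> nat list set" where
  "partitions n = {xs. sorted_wrt (\<ge>) xs \<and> (\<forall>x\<in>set xs. x \<ge> 1) \<and> sum_list xs = n}"

definition difference_at_least_2 :: "nat list \<Rightarrow> bool" where
  "difference_at_least_2 xs \<longleftrightarrow>
     (\<forall>i. Suc i < length xs \<longrightarrow> int (xs ! i) - int (xs ! Suc i) \<ge> 2)"

lemma finite_partitions: "finite (partitions n)"
proof (rule finite_subset)
  show "partitions n \<subseteq> {xs. set xs \<subseteq> {..n} \<and> length xs \<le> n}"
  proof
    fix xs assume xs: "xs \<in> partitions n"
    have "length xs \<le> sum_list xs" if "\<forall>x\<in>set xs. x \<ge> 1" for xs :: "nat list"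
      using that by (induction xs) auto
    then show "xs \<in> {xs. set xs \<subseteq> {..n} \<and> length xs \<le> n}"
      using xs member_le_sum_list by (fastforce simp: partitions_def)
  qed
  show "finite {xs. set xs \<subseteq> {..n} \<and> length xs \<le> n}"
    by (rule finite_lists_length_le) simp
qed

end

theory Submission
  imports Defs "HOL-Computational_Algebra.Formal_Power_Series" "HOL-Library.Multiset"
begin

text \<open>
  Write \<open>R n\<close> for the number of partitions of \<open>n\<close> into parts \<open>\<equiv> 1, 4 (mod 5)\<close>. By the first
  Rogers--Ramanujan identity (\<open>rogers_ramanujan_first\<close>) it is also the number of partitions of
  \<open>n\<close> with difference at least 2. The refinement follows by counting ``at least \<open>k\<close>'' instead of
  ``exactly \<open>k\<close>''. Removing \<open>k\<close> copies of \<open>M\<close> shows that \<open>R (n - k * M)\<close> partitions of the first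
  kind contain \<open>M\<close> at least \<open>k\<close> times. Subtracting \<open>k * M\<close> from the largest part shows that
  \<open>R (n - k * M)\<close> partitions of the second kind have a leading gap that allows this; when the
  single part \<open>k * M\<close> is used up, the result is the empty partition, which is why one-part
  partitions have their own clause. Differences of consecutive values of \<open>k\<close> give the theorem.

  The identity itself is proved with formal power series in \<open>x\<close>, following Rogers, Ramanujan and
  Selberg. Let \<open>P i\<close> be the generating function of the partitions with difference at least 2 and
  all parts greater than \<open>i\<close>. Looking at the part \<open>i + 1\<close> gives
  \<open>P i = P (i + 1) + x ^ (i + 1) * P (i + 2)\<close>, and \<open>P i\<close> tends to 1. Both properties together
  determine \<open>P 0\<close>. The series
  \<open>(\<Sum>r. (-1) ^ r * x ^ (2*i*r + r*(5*r+1)/2) * (1 - x ^ (2*i+2+4*r)) * (\<Prod>s=1..i. 1 - x ^ (r+s)))\<close>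
  satisfy the same recurrence, because the difference of the two sides telescopes in \<open>r\<close>, and
  they tend to \<open>\<Prod>j. 1 - x ^ j\<close>. So for \<open>i = 0\<close> the series is \<open>P 0 * (\<Prod>j. 1 - x ^ j)\<close>.
  At \<open>i = 0\<close> it is also the theta series
  \<open>\<Sum>r. (-1) ^ r * x ^ (r*(5*r+1)/2)\<close> over all integers \<open>r\<close>, which by the Jacobi triple product
  equals the product of \<open>1 - x ^ j\<close> over \<open>j \<equiv> 0, 2, 3 (mod 5)\<close>. What remains is that
  \<open>P 0\<close> is the inverse of the product over \<open>j \<equiv> 1, 4 (mod 5)\<close>.

  Infinite sums and products are avoided: each coefficient depends on finitely many terms, so all
  comparisons are made modulo \<open>x ^ N\<close> with truncations that are long enough for \<open>N\<close>.
\<close>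

section \<open>Agreement of power series up to a given order\<close>

definition agree_below :: "'a::comm_ring_1 fps \<Rightarrow> nat \<Rightarrow> 'a fps \<Rightarrow> bool"
    ("(_ \<simeq>\<^bsub>_\<^esub> _)" [51, 0, 51] 50) where
  "f \<simeq>\<^bsub>N\<^esub> g \<longleftrightarrow> fps_X ^ N dvd f - g"

lemma agree_nth:
  assumes "f \<simeq>\<^bsub>N\<^esub> g" and "n < N"
  shows "fps_nth f n = fps_nth g n"
proof -
  obtain c where "f - g = fps_X ^ N * c"
    using assms(1) unfolding agree_below_def by (elim dvdE)
  then have "fps_nth (f - g) n = 0"
    using assms(2) by (simp add: fps_X_power_mult_nth)
  then show ?thesis by simp
qed

lemma agreeI:
  assumes "\<And>n. n < N \<Longrightarrow> fps_nth f n = fps_nth g n"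
  shows "f \<simeq>\<^bsub>N\<^esub> g"
proof -
  have "fps_cutoff N (f - g) = 0"
    using assms by (auto simp: fps_eq_iff)
  then have "f - g = fps_X ^ N * fps_shift N (f - g)"
    using fps_shift_cutoff'[of N "f - g"] by simp
  then show ?thesis unfolding agree_below_def by (metis dvd_triv_left)
qed

lemma agree_refl [simp]: "f \<simeq>\<^bsub>N\<^esub> f"
  by (simp add: agree_below_def)

lemma agree_sym: "f \<simeq>\<^bsub>N\<^esub> g \<Longrightarrow> g \<simeq>\<^bsub>N\<^esub> f"
  by (metis agree_below_def dvd_minus_iff minus_diff_eq)

lemma agree_trans [trans]: "f \<simeq>\<^bsub>N\<^esub> g \<Longrightarrow> g \<simeq>\<^bsub>N\<^esub> h \<Longrightarrow> f \<simeq>\<^bsub>N\<^esub> h"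
  unfolding agree_below_def using dvd_add[of "fps_X ^ N" "f - g" "g - h"] by simp

lemma agree_add: "f \<simeq>\<^bsub>N\<^esub> g \<Longrightarrow> f' \<simeq>\<^bsub>N\<^esub> g' \<Longrightarrow> f + f' \<simeq>\<^bsub>N\<^esub> g + g'"
  unfolding agree_below_def
  using dvd_add[of "fps_X ^ N" "f - g" "f' - g'"] by (simp add: algebra_simps)

lemma agree_diff: "f \<simeq>\<^bsub>N\<^esub> g \<Longrightarrow> f' \<simeq>\<^bsub>N\<^esub> g' \<Longrightarrow> f - f' \<simeq>\<^bsub>N\<^esub> g - g'"
  unfolding agree_below_def
  using dvd_diff[of "fps_X ^ N" "f - g" "f' - g'"] by (simp add: algebra_simps)

lemma agree_mult:
  assumes "f \<simeq>\<^bsub>N\<^esub> g" and "f' \<simeq>\<^bsub>N\<^esub> g'"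
  shows "f * f' \<simeq>\<^bsub>N\<^esub> g * g'"
proof -
  have "f * f' - g * g' = (f - g) * f' + g * (f' - g')" by (simp add: algebra_simps)
  then show ?thesis using assms unfolding agree_below_def by (simp add: dvd_add)
qed

lemma agree_sum: "(\<And>x. x \<in> A \<Longrightarrow> f x \<simeq>\<^bsub>N\<^esub> g x) \<Longrightarrow> sum f A \<simeq>\<^bsub>N\<^esub> sum g A"
  by (induction A rule: infinite_finite_induct) (auto intro: agree_add)

text \<open>
  This replaces division by infinite products: a finite product of factors \<open>1 - x ^ j\<close> has
  constant coefficient 1 and is therefore a unit.
\<close>

lemma agree_cancel_unit:
  assumes "u dvd 1" and "u * f \<simeq>\<^bsub>N\<^esub> u * g"
  shows "f \<simeq>\<^bsub>N\<^esub> g"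
proof -
  obtain v where v: "u * v = 1" using assms(1) by (metis dvdE)
  have "f - g = v * (u * f - u * g)"
    using v by (metis mult.assoc mult.commute mult_1 right_diff_distrib)
  then show ?thesis using assms(2) unfolding agree_below_def by (metis dvd_mult)
qed

lemma X_power_agree_0: "N \<le> k \<Longrightarrow> fps_X ^ k * f \<simeq>\<^bsub>N\<^esub> 0"
  by (simp add: agree_below_def le_imp_power_dvd)

section \<open>Gaussian binomial coefficients and a finite Jacobi triple product\<close>

definition qfact :: "'a::comm_ring_1 \<Rightarrow> nat \<Rightarrow> 'a" where
  "qfact q n = (\<Prod>j<n. 1 - q ^ Suc j)"

lemma qfact_Suc: "qfact q (Suc n) = qfact q n * (1 - q ^ Suc n)"
  by (simp add: qfact_def)

text \<open>
  The Pascal rule defines the coefficient without division, so that it makes sense in any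
  commutative ring; the quotient formula becomes \<open>qbinomial_qfact\<close>.
\<close>

fun qbinomial :: "'a::comm_ring_1 \<Rightarrow> nat \<Rightarrow> nat \<Rightarrow> 'a" where
  "qbinomial q n 0 = 1"
| "qbinomial q 0 (Suc k) = 0"
| "qbinomial q (Suc n) (Suc k) = qbinomial q n k + q ^ Suc k * qbinomial q n (Suc k)"

lemma qbinomial_eq_0: "n < k \<Longrightarrow> qbinomial q n k = 0"
  by (induction q n k rule: qbinomial.induct) auto

lemma qbinomial_qfact:
  "k \<le> n \<Longrightarrow> qbinomial q n k * qfact q k * qfact q (n - k) = qfact q n"
proof (induction q n k rule: qbinomial.induct)
  case (3 q n k)
  show ?case
  proof (cases "k = n")
    case True
    have "qbinomial q n n * qfact q n * qfact q 0 = qfact q n"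
      using 3(1) True by simp
    then show ?thesis
      using True by (simp add: qbinomial_eq_0 qfact_Suc qfact_def[of q 0] flip: mult.assoc)
  next
    case False
    then obtain d where d: "n = Suc (k + d)"
      using 3(3) less_iff_Suc_add[of k n] by auto
    have 1: "qbinomial q n k * qfact q k * (qfact q d * (1 - q ^ Suc d)) = qfact q n"
      using 3(1) d by (simp add: qfact_Suc Suc_diff_le)
    have 2: "qbinomial q n (Suc k) * (qfact q k * (1 - q ^ Suc k)) * qfact q d = qfact q n"
      using 3(2) d by (simp add: qfact_Suc)
    have "qbinomial q (Suc n) (Suc k) * qfact q (Suc k) * qfact q (Suc n - Suc k)
        = (1 - q ^ Suc k) * (qbinomial q n k * qfact q k * (qfact q d * (1 - q ^ Suc d)))
          + q ^ Suc k * (1 - q ^ Suc d)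
            * (qbinomial q n (Suc k) * (qfact q k * (1 - q ^ Suc k)) * qfact q d)"
      using d by (simp add: qfact_Suc Suc_diff_le del: power_Suc) (simp add: algebra_simps)
    also have "\<dots> = (1 - q ^ Suc k * q ^ Suc d) * qfact q n"
      unfolding 1 2 by (simp add: algebra_simps)
    also have "q ^ Suc k * q ^ Suc d = q ^ Suc n"
      unfolding d power_add[symmetric] by simp
    finally show ?thesis by (simp add: qfact_Suc mult.commute)
  qed
qed (simp_all add: qfact_def)

lemma choose_two_0: "0 choose 2 = 0"
  by simp

lemma choose_two_Suc: "Suc k choose 2 = k + (k choose 2)"
  by (simp add: numeral_2_eq_2)

text \<open>
  The first factor is split off, not the last: the remaining product is then the same statement
  with \<open>b * q\<close> for \<open>b\<close>, and the coefficients combine by exactly the Pascal rule that defines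
  \<open>qbinomial\<close>.
\<close>

lemma qbinomial_theorem:
  fixes q a b :: "'a::comm_ring_1"
  shows "(\<Prod>j<n. a + b * q ^ j)
       = (\<Sum>k\<le>n. q ^ (k choose 2) * qbinomial q n k * b ^ k * a ^ (n - k))"
proof (induction n arbitrary: b)
  case 0
  show ?case by (simp add: choose_two_0)
next
  case (Suc n)
  define t where "t k = q ^ (k choose 2) * qbinomial q n k * (b * q) ^ k * a ^ (n - k)" for k
  have t_Suc: "t (Suc n) = 0"
    by (simp add: t_def qbinomial_eq_0)
  have "(\<Prod>j<Suc n. a + b * q ^ j) = (a + b) * (\<Prod>j<n. a + b * q * q ^ j)"
    by (subst prod.lessThan_Suc_shift) (simp add: mult.assoc)
  also have "\<dots> = (a + b) * (\<Sum>k\<le>n. t k)"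
    unfolding Suc.IH t_def ..
  also have "\<dots> = a * (\<Sum>k\<le>Suc n. t k) + (\<Sum>k\<le>n. b * t k)"
    using t_Suc by (simp add: distrib_right flip: sum_distrib_left)
  also have "\<dots> = a * t 0 + (\<Sum>k\<le>n. a * t (Suc k) + b * t k)"
    by (simp only: sum.atMost_Suc_shift distrib_left sum_distrib_left sum.distrib add.assoc)
  also have "(\<Sum>k\<le>n. a * t (Suc k) + b * t k)
      = (\<Sum>k\<le>n. q ^ (Suc k choose 2) * qbinomial q (Suc n) (Suc k) * b ^ Suc k * a ^ (Suc n - Suc k))"
  proof (rule sum.cong[OF refl])
    fix k assume "k \<in> {..n}"
    then have "k = n \<or> (\<exists>d. n = Suc (k + d))" using less_iff_Suc_add[of k n] by auto
    then show "a * t (Suc k) + b * t k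
      = q ^ (Suc k choose 2) * qbinomial q (Suc n) (Suc k) * b ^ Suc k * a ^ (Suc n - Suc k)"
      by (auto simp: t_def choose_two_Suc power_add qbinomial_eq_0 power_mult_distrib
          Suc_diff_le algebra_simps)
  qed
  also have "a * t 0 + \<dots>
      = (\<Sum>k\<le>Suc n. q ^ (k choose 2) * qbinomial q (Suc n) k * b ^ k * a ^ (Suc n - k))"
    by (subst sum.atMost_Suc_shift) (simp add: t_def)
  finally show ?case .
qed

lemma choose_two_add: "(m + n) choose 2 = (m choose 2) + (n choose 2) + m * n"
  by (induction m) (simp_all add: choose_two_Suc)

lemma two_choose_two: "(r choose 2) + (r choose 2) + r = r * r"
  by (induction r) (simp_all add: choose_two_Suc)

lemma sum_lessThan_add:
  fixes f :: "nat \<Rightarrow> 'a::comm_monoid_add"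
  shows "(\<Sum>k<m + n. f k) = (\<Sum>k<m. f k) + (\<Sum>k<n. f (m + k))"
  by (induction n) (simp_all add: add.assoc)

lemma prod_lessThan_add:
  fixes f :: "nat \<Rightarrow> 'a::comm_monoid_mult"
  shows "(\<Prod>k<m + n. f k) = (\<Prod>k<m. f k) * (\<Prod>k<n. f (m + k))"
  by (induction n) (simp_all add: mult.assoc)

text \<open>
  With \<open>q = u * v\<close>, this is the binomial theorem for \<open>2 * m\<close> factors \<open>a - q ^ j\<close> with
  \<open>a = u * q ^ (m - 1)\<close>. The first \<open>m\<close> factors are \<open>- (q ^ j) * (1 - u * q ^ (m - 1 - j))\<close>, and
  the factor with \<open>j = m + t\<close> is \<open>a * (1 - v * q ^ t)\<close>. So the common factor
  \<open>(-1) ^ m * q ^ (m choose 2) * a ^ m\<close> comes out of the product and must cancel; this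
  is where \<open>u\<close> and \<open>v\<close> have to be nonzero. The expansion, indexed from its middle term in both
  directions, gives the two sums.
\<close>

theorem finite_triple_product:
  fixes u v :: "'a::idom"
  assumes "u \<noteq> 0" and "v \<noteq> 0"
  shows "(\<Prod>t<m. (1 - u * (u * v) ^ t) * (1 - v * (u * v) ^ t))
       = (\<Sum>r\<le>m. (-1) ^ r * (u * v) ^ (r choose 2) * u ^ r * qbinomial (u * v) (2 * m) (m - r))
       - (\<Sum>r<m. (-1) ^ r * (u * v) ^ (Suc r choose 2) * v ^ Suc r
                  * qbinomial (u * v) (2 * m) (m + Suc r))"
    (is "?P = ?A - ?B")
proof (cases m)
  case 0
  then show ?thesis by (simp add: choose_two_0)
next
  case m: (Suc m')
  define q where "q = u * v"
  define c where "c = (-1) ^ m * q ^ (m choose 2) * (u * q ^ m') ^ m"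
  have "c \<noteq> 0" using assms by (simp add: c_def q_def)
  define f where "f k = q ^ (k choose 2) * qbinomial q (2 * m) k * (-1) ^ k * (u * q ^ m') ^ (2 * m - k)" for k
  have "(\<Prod>j<2 * m. u * q ^ m' + (-1) * q ^ j)
      = (\<Prod>j<m. u * q ^ m' - q ^ j) * (\<Prod>t<m. u * q ^ m' - q ^ (m + t))"
    unfolding mult_2 by (simp add: prod_lessThan_add)
  also have "(\<Prod>j<m. u * q ^ m' - q ^ j) = (\<Prod>j<m. - (q ^ j) * (1 - u * q ^ (m' - j)))"
    by (rule prod.cong) (auto simp: m algebra_simps simp flip: power_add)
  also have "\<dots> = (-1) ^ m * q ^ (m choose 2) * (\<Prod>t<m. 1 - u * q ^ t)"
  proof -
    have "(\<Prod>j<m. 1 - u * q ^ (m' - j)) = (\<Prod>t<m. 1 - u * q ^ t)"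
      using prod.nat_diff_reindex[of "\<lambda>t. 1 - u * q ^ t" m] by (simp add: m)
    moreover have "(\<Prod>j<n. - (q ^ j)) = (-1) ^ n * q ^ (n choose 2)" for n
      by (induction n) (simp_all add: choose_two_0 choose_two_Suc power_add)
    ultimately show ?thesis by (simp only: prod.distrib)
  qed
  also have "(\<Prod>t<m. u * q ^ m' - q ^ (m + t)) = (\<Prod>t<m. (u * q ^ m') * (1 - v * q ^ t))"
    by (rule prod.cong) (auto simp: m algebra_simps power_add q_def)
  also have "\<dots> = (u * q ^ m') ^ m * (\<Prod>t<m. 1 - v * q ^ t)"
    by (simp add: prod.distrib)
  finally have "c * ?P = (\<Sum>k\<le>2 * m. f k)"
    unfolding qbinomial_theorem f_def c_def q_def[symmetric] prod.distrib
    by (simp add: algebra_simps)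
  also have "\<dots> = (\<Sum>r\<le>m. f (m - r)) + (\<Sum>r<m. f (m + Suc r))"
  proof -
    have "(\<Sum>k<Suc m + m. f k) = (\<Sum>k<Suc m. f k) + (\<Sum>r<m. f (Suc m + r))"
      by (rule sum_lessThan_add)
    moreover have "(\<Sum>k<Suc m. f k) = (\<Sum>r<Suc m. f (m - r))"
      using sum.nat_diff_reindex[of f "Suc m"] by simp
    moreover have "{..2 * m} = {..<Suc m + m}" by auto
    ultimately show ?thesis by (simp only: lessThan_Suc_atMost add_Suc_shift)
  qed
  also have "(\<Sum>r\<le>m. f (m - r)) = c * ?A"
    unfolding sum_distrib_left
  proof (rule sum.cong[OF refl])
    fix r assume "r \<in> {..m}"
    then obtain d where d: "m = r + d" using le_Suc_ex by auto
    have e: "(d choose 2) + m' * r = (m choose 2) + (r choose 2)"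
    proof -
      have "m' * r + r = r * r + d * r" using m d by (metis add_mult_distrib mult_Suc add.commute)
      then show ?thesis using two_choose_two[of r] by (simp add: d choose_two_add algebra_simps)
    qed
    have "f (m - r) = q ^ ((d choose 2) + m' * r) * qbinomial q (2 * m) (m - r) * (-1) ^ d
        * u ^ r * (u * q ^ m') ^ m"
      by (simp add: f_def d power_add power_mult_distrib power_mult algebra_simps mult_2
          power2_eq_square)
    also have "(-1 :: 'a) ^ d = (-1) ^ m * (-1) ^ r"
      by (simp add: d power_add)
    finally show "f (m - r) = c * ((-1) ^ r * (u * v) ^ (r choose 2) * u ^ r
        * qbinomial (u * v) (2 * m) (m - r))"
      unfolding e c_def q_def[symmetric] by (simp add: power_add algebra_simps)
  qed
  also have "(\<Sum>r<m. f (m + Suc r)) = - (c * ?B)"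
    unfolding sum_distrib_left sum_negf[symmetric]
  proof (rule sum.cong[OF refl])
    fix r assume "r \<in> {..<m}"
    then obtain d where d: "m = Suc r + d" using less_iff_Suc_add[of r m] by auto
    have m': "m' = r + d" using m d by simp
    have e: "(m + Suc r choose 2) + m' * d = (Suc r choose 2) + Suc r + (m choose 2) + m' * m"
      by (simp add: d m' choose_two_add choose_two_Suc algebra_simps)
    have "f (m + Suc r) = q ^ ((m + Suc r choose 2) + m' * d)
        * qbinomial q (2 * m) (m + Suc r) * (-1) ^ (m + Suc r) * u ^ d"
    proof -
      have "2 * m - (m + Suc r) = d" by (simp add: d)
      then show ?thesis
        unfolding f_def power_add power_mult_distrib power_mult by (simp add: mult_ac)
    qed
    also have "\<dots> = - (c * ((-1) ^ r * (u * v) ^ (Suc r choose 2) * v ^ Suc r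
        * qbinomial (u * v) (2 * m) (m + Suc r)))"
    proof -
      have "u ^ m * v ^ Suc r = u ^ d * q ^ Suc r"
        unfolding d power_add q_def power_mult_distrib by (simp add: algebra_simps)
      then have cv: "c * ((-1) ^ r * q ^ (Suc r choose 2) * v ^ Suc r * Q)
          = (-1) ^ (m + r) * q ^ ((Suc r choose 2) + Suc r + (m choose 2) + m' * m) * u ^ d * Q" for Q
        unfolding c_def power_add power_mult power_mult_distrib by (simp add: algebra_simps)
      show ?thesis
        unfolding e q_def[symmetric] cv by (simp add: mult_ac)
    qed
    finally show "f (m + Suc r) = - (c * ((-1) ^ r * (u * v) ^ (Suc r choose 2) * v ^ Suc r
        * qbinomial (u * v) (2 * m) (m + Suc r)))" .
  qed
  finally have "c * ?P = c * (?A - ?B)" by (simp add: algebra_simps)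
  with \<open>c \<noteq> 0\<close> show ?thesis by (simp only: mult_cancel_left) simp
qed


section \<open>The telescoping recurrence\<close>

text \<open>
  This is \<open>r * (5 * r + 1) / 2\<close>, the exponent in the theta series. The form with a binomial
  coefficient needs no division and is the exponent of \<open>(x ^ 5) ^ (r choose 2) * (x ^ 3) ^ r\<close>,
  as it comes out of the triple product.
\<close>

definition pent :: "nat \<Rightarrow> nat" where
  "pent r = 5 * (r choose 2) + 3 * r"

lemma pent_0 [simp]: "pent 0 = 0"
  by (simp add: pent_def choose_two_0)

lemma pent_Suc: "pent (Suc r) = pent r + 5 * r + 3"
  by (simp add: pent_def choose_two_Suc)

lemma pent_ge: "r \<le> pent r"
  by (simp add: pent_def)

text \<open>This is the quotient of \<open>qfact x (r + i)\<close> by \<open>qfact x r\<close>.\<close>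

definition shifted_qfact :: "'a::comm_ring_1 \<Rightarrow> nat \<Rightarrow> nat \<Rightarrow> 'a" where
  "shifted_qfact x i r = (\<Prod>s<i. 1 - x ^ (r + Suc s))"

lemma shifted_qfact_last:
  "shifted_qfact x (Suc i) r = shifted_qfact x i r * (1 - x ^ (r + Suc i))"
  by (simp add: shifted_qfact_def)

lemma shifted_qfact_first:
  "shifted_qfact x (Suc i) r = (1 - x ^ Suc r) * shifted_qfact x i (Suc r)"
  unfolding shifted_qfact_def by (subst prod.lessThan_Suc_shift) simp

text \<open>
  In Selberg's notation, \<open>main_term\<close> and \<open>mid_term\<close> are the terms of the series \<open>H 2\<close> and \<open>H 1\<close>
  at \<open>a = x ^ (i + 1)\<close>, multiplied by \<open>\<Prod>j. 1 - x ^ j\<close>. This factor turns the denominators of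
  \<open>H m\<close> into the polynomials \<open>shifted_qfact x i r\<close>. The relations \<open>H 1 a = H 2 (a * x)\<close> and
  \<open>H 2 a - H 1 a = a * H 1 (a * x)\<close> become the two telescoping lemmas below.
\<close>

definition main_term :: "'a::comm_ring_1 \<Rightarrow> nat \<Rightarrow> nat \<Rightarrow> 'a" where
  "main_term x i r =
     (-1) ^ r * x ^ (2 * i * r + pent r) * (1 - x ^ (2 * i + 2 + 4 * r)) * shifted_qfact x i r"

definition mid_term :: "'a::comm_ring_1 \<Rightarrow> nat \<Rightarrow> nat \<Rightarrow> 'a" where
  "mid_term x i r =
     (-1) ^ r * x ^ ((2 * i + 1) * r + pent r) * (1 - x ^ (i + 1 + 2 * r)) * shifted_qfact x i r"

definition boundary_term :: "'a::comm_ring_1 \<Rightarrow> nat \<Rightarrow> nat \<Rightarrow> nat \<Rightarrow> 'a" where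
  "boundary_term x c i r = (-1) ^ r * x ^ (c * r + pent r) * (1 - x ^ r) * shifted_qfact x i r"

text \<open>
  The factor \<open>1 - x ^ Suc r\<close> of the boundary term extends the product \<open>shifted_qfact x i (Suc r)\<close>
  downwards by one factor, which turns it into a product that starts where the terms with index
  \<open>r\<close> start. So the boundary term at \<open>Suc r\<close> can be combined with those terms.
\<close>

lemma boundary_term_Suc:
  "boundary_term x c i (Suc r)
   = - ((-1) ^ r * x ^ (c * r + pent r) * x ^ (c + 5 * r + 3)
        * (shifted_qfact x i r * (1 - x ^ (r + Suc i))))"
  unfolding shifted_qfact_last[symmetric] shifted_qfact_first
  by (simp add: boundary_term_def pent_Suc power_add algebra_simps)

text \<open>
  The reason is the splitting
  \<open>1 - x ^ (i+1+2*r) = (1 - x ^ r) + x ^ r * (1 - x ^ (r+i+1))\<close>. The first summand gives the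
  boundary term at \<open>r\<close>; the second, combined with the boundary term at \<open>Suc r\<close>, gives
  \<open>main_term x (Suc i) r\<close>. The powers of \<open>x\<close> are written as monomials in \<open>x\<close>, \<open>y = x ^ r\<close> and
  \<open>z = x ^ i\<close> to leave an identity of polynomials.
\<close>

lemma mid_term_telescope:
  "mid_term x i r = main_term x (Suc i) r
     + (boundary_term x (2 * i + 1) i r - boundary_term x (2 * i + 1) i (Suc r))"
proof -
  define A where "A = (-1) ^ r * x ^ ((2 * i + 1) * r + pent r) * shifted_qfact x i r"
  define y where "y = x ^ r"
  define z where "z = x ^ i"
  have 1: "mid_term x i r = A * (1 - z * x * y ^ 2)"
    by (simp add: mid_term_def A_def y_def z_def power_add mult_ac flip: power_mult)
  have 2: "main_term x (Suc i) r = A * y * (1 - z ^ 2 * x ^ 4 * y ^ 4) * (1 - y * z * x)"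
    unfolding main_term_def shifted_qfact_last
    by (simp add: A_def y_def z_def power_add power_mult_distrib mult_ac eval_nat_numeral
        flip: power_mult)
  have 3: "boundary_term x (2 * i + 1) i r = A * (1 - y)"
    by (simp add: boundary_term_def A_def y_def mult_ac)
  have 4: "boundary_term x (2 * i + 1) i (Suc r) = - (A * (z ^ 2 * x ^ 4 * y ^ 5 * (1 - y * z * x)))"
    unfolding boundary_term_Suc
    by (simp add: A_def y_def z_def power_add power_mult_distrib mult_ac eval_nat_numeral
        flip: power_mult)
  show ?thesis unfolding 1 2 3 4 by (simp add: algebra_simps eval_nat_numeral)
qed

text \<open>
  Here the splitting is \<open>(1 - x ^ (2*i+2+4*r)) - x ^ r * (1 - x ^ (i+1+2*r))
  = (1 - x ^ r) + x ^ (i+1+3*r) * (1 - x ^ (r+i+1))\<close>, used in the same way.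
\<close>

lemma main_term_telescope:
  "main_term x i r = mid_term x i r + x ^ Suc i * mid_term x (Suc i) r
     + (boundary_term x (2 * i) i r - boundary_term x (2 * i) i (Suc r))"
proof -
  define A where "A = (-1) ^ r * x ^ (2 * i * r + pent r) * shifted_qfact x i r"
  define y where "y = x ^ r"
  define z where "z = x ^ i"
  have 0: "main_term x i r = A * (1 - z ^ 2 * x ^ 2 * y ^ 4)"
    by (simp add: main_term_def A_def y_def z_def power_add mult_ac eval_nat_numeral
        flip: power_mult)
  have 1: "mid_term x i r = A * y * (1 - z * x * y ^ 2)"
    by (simp add: mid_term_def A_def y_def z_def power_add mult_ac flip: power_mult)
  have 2: "mid_term x (Suc i) r = A * y ^ 3 * (1 - z * x ^ 2 * y ^ 2) * (1 - y * z * x)"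
    unfolding mid_term_def shifted_qfact_last
    by (simp add: A_def y_def z_def power_add power_mult_distrib mult_ac eval_nat_numeral
        flip: power_mult)
  have 3: "boundary_term x (2 * i) i r = A * (1 - y)"
    by (simp add: boundary_term_def A_def y_def mult_ac)
  have 4: "boundary_term x (2 * i) i (Suc r) = - (A * (z ^ 2 * x ^ 3 * y ^ 5 * (1 - y * z * x)))"
    unfolding boundary_term_Suc
    by (simp add: A_def y_def z_def power_add power_mult_distrib mult_ac eval_nat_numeral
        flip: power_mult)
  have 5: "x ^ Suc i = x * z" by (simp add: z_def)
  show ?thesis unfolding 0 1 2 3 4 5 by (simp add: algebra_simps eval_nat_numeral)
qed

text \<open>
  The boundary term vanishes at 0 because of its factor \<open>1 - x ^ r\<close>, and at \<open>N\<close> it is divisible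
  by \<open>x ^ N\<close> because \<open>pent N \<ge> N\<close>.
\<close>

lemma boundary_sum_agree:
  "(\<Sum>r<N. boundary_term fps_X c i r - boundary_term fps_X c i (Suc r)) \<simeq>\<^bsub>N\<^esub> 0"
proof -
  have "(\<Sum>r<N. boundary_term fps_X c i r - boundary_term fps_X c i (Suc r))
      = boundary_term fps_X c i 0 - boundary_term fps_X c i N"
    by (rule sum_lessThan_telescope')
  also have "\<dots> = fps_X ^ (c * N + pent N) * (- ((-1) ^ N * (1 - fps_X ^ N) * shifted_qfact fps_X i N))"
    by (simp add: boundary_term_def mult_ac)
  also have "\<dots> \<simeq>\<^bsub>N\<^esub> 0"
    using pent_ge[of N] by (intro X_power_agree_0) simp
  finally show ?thesis .
qed

definition main_sum :: "nat \<Rightarrow> nat \<Rightarrow> 'a::comm_ring_1 fps" where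
  "main_sum N i = (\<Sum>r<N. main_term fps_X i r)"

lemma mid_sum_agree: "(\<Sum>r<N. mid_term fps_X i r) \<simeq>\<^bsub>N\<^esub> main_sum N (Suc i)"
  using agree_add[OF agree_refl boundary_sum_agree]
  by (simp add: mid_term_telescope sum.distrib main_sum_def)

lemma main_sum_recurrence:
  "main_sum N i \<simeq>\<^bsub>N\<^esub> main_sum N (Suc i) + fps_X ^ Suc i * main_sum N (Suc (Suc i))"
proof -
  have "main_sum N i = (\<Sum>r<N. mid_term fps_X i r) + fps_X ^ Suc i * (\<Sum>r<N. mid_term fps_X (Suc i) r)
      + (\<Sum>r<N. boundary_term fps_X (2 * i) i r - boundary_term fps_X (2 * i) i (Suc r))"
    unfolding main_sum_def main_term_telescope sum.distrib sum_distrib_left ..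
  also have "\<dots> \<simeq>\<^bsub>N\<^esub> main_sum N (Suc i) + fps_X ^ Suc i * main_sum N (Suc (Suc i)) + 0"
    by (intro agree_add agree_mult agree_refl mid_sum_agree boundary_sum_agree)
  finally show ?thesis by simp
qed

lemma one_minus_X_power_agree_1: "N \<le> k \<Longrightarrow> 1 - fps_X ^ k \<simeq>\<^bsub>N\<^esub> 1"
  using X_power_agree_0[of N k "-1"] by (simp add: agree_below_def)

lemma qfact_agree:
  assumes "d \<ge> 1" and "N \<le> n"
  shows "qfact (fps_X ^ d) n \<simeq>\<^bsub>N\<^esub> qfact (fps_X ^ d) N"
  using assms(2)
proof (induction n rule: dec_induct)
  case (step n)
  have "N \<le> d * Suc n" using step(1) assms(1) by (metis le_SucI le_trans mult_le_mono1 mult_1)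
  then have "1 - (fps_X ^ d) ^ Suc n \<simeq>\<^bsub>N\<^esub> 1"
    unfolding power_mult[symmetric] by (rule one_minus_X_power_agree_1)
  then show ?case
    unfolding qfact_Suc using agree_mult[OF step(3)] by (metis mult_1_right)
qed simp

lemma qfact_X_agree: "N \<le> n \<Longrightarrow> qfact fps_X n \<simeq>\<^bsub>N\<^esub> qfact fps_X N"
  using qfact_agree[of 1 N n] by simp

lemma sum_agree_truncated:
  assumes "N \<le> m"
    and "\<And>r. r < N \<Longrightarrow> f r \<simeq>\<^bsub>N\<^esub> g r"
    and "\<And>r. N \<le> r \<Longrightarrow> r < m \<Longrightarrow> f r \<simeq>\<^bsub>N\<^esub> 0"
  shows "(\<Sum>r<m. f r) \<simeq>\<^bsub>N\<^esub> (\<Sum>r<N. g r)"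
proof -
  obtain d where m: "m = N + d" using assms(1) le_Suc_ex by auto
  have "(\<Sum>r<m. f r) = (\<Sum>r<N. f r) + (\<Sum>r<d. f (N + r))"
    unfolding m by (rule sum_lessThan_add)
  also have "\<dots> \<simeq>\<^bsub>N\<^esub> (\<Sum>r<N. g r) + (\<Sum>r<d. 0)"
    by (intro agree_add agree_sum) (use assms m in auto)
  finally show ?thesis by simp
qed

text \<open>
  For large \<open>i\<close> only \<open>r = 0\<close> survives, since the exponent contains \<open>2 * i * r\<close>. This is the
  initial condition at infinity of the recurrence.
\<close>

lemma main_sum_large:
  assumes "N \<le> i"
  shows "main_sum N i \<simeq>\<^bsub>N\<^esub> qfact fps_X N"
proof (cases N)
  case 0
  then show ?thesis by (simp add: agree_below_def)
next
  case (Suc N')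
  have *: "main_term fps_X i (Suc r) \<simeq>\<^bsub>N\<^esub> 0" for r
  proof -
    have "main_term fps_X i (Suc r) = fps_X ^ (2 * i * Suc r + pent (Suc r)) *
        ((-1) ^ Suc r * (1 - fps_X ^ (2 * i + 2 + 4 * Suc r)) * shifted_qfact fps_X i (Suc r))"
      by (simp add: main_term_def mult_ac)
    also have "\<dots> \<simeq>\<^bsub>N\<^esub> 0"
      using assms by (intro X_power_agree_0) simp
    finally show ?thesis .
  qed
  have "main_sum N i = main_term fps_X i 0 + (\<Sum>r<N'. main_term fps_X i (Suc r))"
    unfolding main_sum_def Suc by (rule sum.lessThan_Suc_shift)
  also have "\<dots> \<simeq>\<^bsub>N\<^esub> main_term fps_X i 0 + (\<Sum>r<N'. 0)"
    by (intro agree_add agree_sum agree_refl *)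
  also have "\<dots> = (1 - fps_X ^ (2 * i + 2)) * qfact fps_X i"
    by (simp add: main_term_def shifted_qfact_def qfact_def)
  also have "\<dots> \<simeq>\<^bsub>N\<^esub> 1 * qfact fps_X N"
    by (intro agree_mult one_minus_X_power_agree_1 qfact_X_agree) (use assms in auto)
  finally show ?thesis by simp
qed

section \<open>Partitions with difference at least two\<close>

definition gap_partitions :: "nat \<Rightarrow> nat \<Rightarrow> nat list set" where
  "gap_partitions i n =
     {xs. sorted_wrt (\<lambda>x y. x \<ge> y + 2) xs \<and> (\<forall>x\<in>set xs. x > i) \<and> sum_list xs = n}"

lemma gap_partitions_0_eq:
  "gap_partitions 0 n = {xs \<in> partitions n. difference_at_least_2 xs}"
proof -
  have tr: "transp (\<lambda>x y. x \<ge> y + (2 :: nat))" by (auto simp: transp_def)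
  have "difference_at_least_2 xs \<longleftrightarrow> sorted_wrt (\<lambda>x y. x \<ge> y + 2) xs" for xs
    unfolding difference_at_least_2_def sorted_wrt_iff_nth_Suc_transp[OF tr] by fastforce
  moreover have "sorted_wrt (\<lambda>x y. x \<ge> y + 2) xs \<Longrightarrow> sorted_wrt (\<ge>) xs" for xs :: "nat list"
    by (erule sorted_wrt_mono_rel[rotated]) simp
  ultimately show ?thesis
    by (auto simp: gap_partitions_def partitions_def Suc_le_eq)
qed

lemma finite_gap_partitions: "finite (gap_partitions i n)"
proof (rule finite_subset)
  show "gap_partitions i n \<subseteq> gap_partitions 0 n"
    by (auto simp: gap_partitions_def)
  show "finite (gap_partitions 0 n)"
    unfolding gap_partitions_0_eq by (simp add: finite_partitions)
qed

text \<open>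
  The partitions that contain the part \<open>Suc i\<close> have it at the very end; when it is removed, the
  other parts are at least \<open>i + 3\<close>, hence the jump by two in the first index.
\<close>

lemma card_gap_partitions_recurrence:
  "card (gap_partitions i n) = card (gap_partitions (Suc i) n)
     + (if n < Suc i then 0 else card (gap_partitions (Suc (Suc i)) (n - Suc i)))"
proof -
  let ?f = "\<lambda>xs :: nat list. xs @ [Suc i]"
  define B where "B = (if n < Suc i then {} else ?f ` gap_partitions (Suc (Suc i)) (n - Suc i))"
  have "gap_partitions i n = gap_partitions (Suc i) n \<union> B"
  proof (intro equalityI subsetI)
    fix xs assume xs: "xs \<in> gap_partitions i n"
    show "xs \<in> gap_partitions (Suc i) n \<union> B"
    proof (cases "Suc i \<in> set xs")
      case False
      have "x > Suc i" if "x \<in> set xs" for x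
        using xs False that by (cases "x = Suc i") (auto simp: gap_partitions_def)
      then show ?thesis using xs by (auto simp: gap_partitions_def)
    next
      case True
      \<comment> \<open>Nothing can stand behind the smallest admissible part.\<close>
      then obtain ys zs where yz: "xs = ys @ Suc i # zs" by (meson split_list)
      have "zs = []"
        using xs unfolding yz by (cases zs) (auto simp: gap_partitions_def sorted_wrt_append)
      then have "ys \<in> gap_partitions (Suc (Suc i)) (n - Suc i)" and "n \<ge> Suc i"
        using xs unfolding yz by (auto simp: gap_partitions_def sorted_wrt_append Suc_le_eq)
      then show ?thesis using yz \<open>zs = []\<close> by (auto simp: B_def)
    qed
  next
    fix xs assume "xs \<in> gap_partitions (Suc i) n \<union> B"
    then show "xs \<in> gap_partitions i n"
      by (auto simp: gap_partitions_def B_def sorted_wrt_append Suc_lessD split: if_splits)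
        (auto dest!: bspec)
  qed
  moreover have "gap_partitions (Suc i) n \<inter> B = {}"
  proof -
    have "Suc i \<in> set xs" if "xs \<in> B" for xs
      using that by (auto simp: B_def split: if_splits)
    moreover have "Suc i \<notin> set xs" if "xs \<in> gap_partitions (Suc i) n" for xs
      using that by (auto simp: gap_partitions_def)
    ultimately show ?thesis by blast
  qed
  moreover have "finite B"
    by (auto simp: B_def finite_gap_partitions)
  ultimately have "card (gap_partitions i n) = card (gap_partitions (Suc i) n) + card B"
    using finite_gap_partitions[of "Suc i" n] by (simp add: card_Un_disjoint)
  moreover have "card (?f ` A) = card A" for A
    by (rule card_image) (auto simp: inj_on_def)
  ultimately show ?thesis by (simp add: B_def)
qed

definition gap_gf :: "nat \<Rightarrow> real fps" where
  "gap_gf i = Abs_fps (\<lambda>n. real (card (gap_partitions i n)))"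

lemma gap_gf_recurrence: "gap_gf i = gap_gf (Suc i) + fps_X ^ Suc i * gap_gf (Suc (Suc i))"
  by (rule fps_ext)
    (simp add: gap_gf_def fps_X_power_mult_nth card_gap_partitions_recurrence[of i] del: power_Suc)

lemma gap_gf_large:
  assumes "N \<le> i"
  shows "gap_gf i \<simeq>\<^bsub>N\<^esub> 1"
proof (rule agreeI)
  fix n assume n: "n < N"
  have "gap_partitions i n = (if n = 0 then {[]} else {})"
  proof -
    have "xs = []" if "xs \<in> gap_partitions i n" for xs
      using that n assms by (cases xs) (auto simp: gap_partitions_def)
    moreover have "[] \<in> gap_partitions i n \<longleftrightarrow> n = 0"
      by (auto simp: gap_partitions_def)
    ultimately show ?thesis
      by (intro set_eqI) (metis empty_iff singleton_iff)
  qed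
  then show "fps_nth (gap_gf i) n = fps_nth 1 n"
    by (simp add: gap_gf_def)
qed

text \<open>
  Both sides obey the same second-order recurrence and agree for all \<open>i \<ge> N\<close>; the induction
  carries the agreement down to smaller \<open>i\<close>.
\<close>

lemma gap_gf_main_sum: "qfact fps_X N * gap_gf i \<simeq>\<^bsub>N\<^esub> main_sum N i"
proof (induction "N - i" arbitrary: i rule: less_induct)
  case less
  show ?case
  proof (cases "N \<le> i")
    case True
    have "qfact fps_X N * gap_gf i \<simeq>\<^bsub>N\<^esub> qfact fps_X N * 1"
      by (intro agree_mult agree_refl gap_gf_large True)
    also have "\<dots> \<simeq>\<^bsub>N\<^esub> main_sum N i"
      using agree_sym[OF main_sum_large[OF True]] by simp
    finally show ?thesis .
  next
    case False
    have "qfact fps_X N * gap_gf i = qfact fps_X N * gap_gf (Suc i)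
        + fps_X ^ Suc i * (qfact fps_X N * gap_gf (Suc (Suc i)))"
      by (subst gap_gf_recurrence) (simp add: algebra_simps)
    also have "\<dots> \<simeq>\<^bsub>N\<^esub> main_sum N (Suc i) + fps_X ^ Suc i * main_sum N (Suc (Suc i))"
      by (intro agree_add agree_mult agree_refl less) (use False in auto)
    also have "\<dots> \<simeq>\<^bsub>N\<^esub> main_sum N i"
      by (rule agree_sym[OF main_sum_recurrence])
    finally show ?thesis .
  qed
qed

section \<open>The product side\<close>

lemma fps_prod_nth_0:
  fixes f :: "'b \<Rightarrow> 'a::comm_ring_1 fps"
  shows "fps_nth (prod f A) 0 = (\<Prod>x\<in>A. fps_nth (f x) 0)"
  by (induction A rule: infinite_finite_induct) simp_all

text \<open>
  Modulo \<open>x ^ N\<close> all \<open>q\<close>-factorials of index at least \<open>N\<close> coincide, so in the quotient formula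
  one of them remains in the denominator.
\<close>

lemma qbinomial_agree:
  assumes "N \<le> k" and "N \<le> n - k" and "k \<le> n"
  shows "qfact (fps_X ^ 5) N * qbinomial (fps_X ^ 5) n k \<simeq>\<^bsub>N\<^esub> (1 :: real fps)"
proof -
  define Q :: "real fps" where "Q = qfact (fps_X ^ 5) N"
  have Q: "qfact (fps_X ^ 5) j \<simeq>\<^bsub>N\<^esub> Q" if "N \<le> j" for j
    unfolding Q_def using that by (intro qfact_agree) auto
  have "Q dvd 1"
    by (simp add: Q_def qfact_def fps_prod_nth_0)
  moreover have "Q * (Q * qbinomial (fps_X ^ 5) n k) \<simeq>\<^bsub>N\<^esub> Q * 1"
  proof -
    have "Q * (Q * qbinomial (fps_X ^ 5) n k) = qbinomial (fps_X ^ 5) n k * Q * Q"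
      by (simp add: mult_ac)
    also have "\<dots> \<simeq>\<^bsub>N\<^esub> qbinomial (fps_X ^ 5) n k * qfact (fps_X ^ 5) k * qfact (fps_X ^ 5) (n - k)"
      by (intro agree_mult agree_refl agree_sym[OF Q] assms)
    also have "\<dots> = qfact (fps_X ^ 5) n"
      using assms by (intro qbinomial_qfact)
    also have "\<dots> \<simeq>\<^bsub>N\<^esub> Q * 1"
      using Q[of n] assms by simp
    finally show ?thesis .
  qed
  ultimately show ?thesis unfolding Q_def by (rule agree_cancel_unit)
qed

text \<open>
  The finite triple product with \<open>u = x ^ 3\<close> and \<open>v = x ^ 2\<close>. A product over \<open>2 * N\<close> indices
  ensures that the coefficients \<open>qbinomial\<close> within distance \<open>N\<close> of the middle satisfy
  the hypotheses of \<open>qbinomial_agree\<close>, while the remaining terms are already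
  divisible by \<open>x ^ N\<close>.
\<close>

lemma triple_product_main_sum:
  "qfact (fps_X ^ 5) N * (\<Prod>t<2 * N. (1 - fps_X ^ (5 * t + 3)) * (1 - fps_X ^ (5 * t + 2)))
     \<simeq>\<^bsub>N\<^esub> (main_sum N 0 :: real fps)"
proof -
  define m where "m = 2 * N"
  define Q :: "real fps" where "Q = qfact (fps_X ^ 5) N"
  define f :: "nat \<Rightarrow> real fps" where
    "f r = (-1) ^ r * fps_X ^ pent r * qbinomial (fps_X ^ 5) (2 * m) (m - r)" for r
  define g :: "nat \<Rightarrow> real fps" where
    "g r = (-1) ^ r * fps_X ^ (pent r + 4 * r + 2) * qbinomial (fps_X ^ 5) (2 * m) (m + Suc r)" for r
  have uv: "fps_X ^ 3 * fps_X ^ 2 = (fps_X ^ 5 :: real fps)"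
    by (simp flip: power_add)
  have "(\<Prod>t<m. (1 - fps_X ^ (5 * t + 3)) * (1 - fps_X ^ (5 * t + 2)))
      = (\<Prod>t<m. (1 - fps_X ^ 3 * (fps_X ^ 3 * fps_X ^ 2) ^ t)
                 * (1 - fps_X ^ 2 * (fps_X ^ 3 * fps_X ^ 2) ^ t) :: real fps)"
    unfolding uv by (simp add: add.commute flip: power_mult power_add)
  also have "\<dots> = (\<Sum>r\<le>m. f r) - (\<Sum>r<m. g r)"
    by (subst finite_triple_product, simp, simp, unfold uv,
        intro arg_cong2[of _ _ _ _ minus] sum.cong refl)
      (simp_all add: f_def g_def pent_def choose_two_Suc algebra_simps flip: power_mult power_add)
  finally have "Q * (\<Prod>t<m. (1 - fps_X ^ (5 * t + 3)) * (1 - fps_X ^ (5 * t + 2)))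
      = (\<Sum>r<Suc m. Q * f r) - (\<Sum>r<m. Q * g r)"
    by (simp add: right_diff_distrib sum_distrib_left lessThan_Suc_atMost del: sum.lessThan_Suc)
  also have "\<dots> \<simeq>\<^bsub>N\<^esub> (\<Sum>r<N. (-1) ^ r * fps_X ^ pent r) - (\<Sum>r<N. (-1) ^ r * fps_X ^ (pent r + 4 * r + 2))"
  proof (intro agree_diff sum_agree_truncated)
    fix r assume "r < N"
    then have 1: "Q * qbinomial (fps_X ^ 5) (2 * m) (m - r) \<simeq>\<^bsub>N\<^esub> 1"
      and 2: "Q * qbinomial (fps_X ^ 5) (2 * m) (m + Suc r) \<simeq>\<^bsub>N\<^esub> 1"
      unfolding Q_def by (intro qbinomial_agree; simp add: m_def)+
    have "Q * f r = (-1) ^ r * fps_X ^ pent r * (Q * qbinomial (fps_X ^ 5) (2 * m) (m - r))"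
      by (simp add: f_def mult_ac)
    also have "\<dots> \<simeq>\<^bsub>N\<^esub> (-1) ^ r * fps_X ^ pent r * 1"
      by (intro agree_mult agree_refl 1)
    finally show "Q * f r \<simeq>\<^bsub>N\<^esub> (-1) ^ r * fps_X ^ pent r" by simp
    have "Q * g r = (-1) ^ r * fps_X ^ (pent r + 4 * r + 2)
        * (Q * qbinomial (fps_X ^ 5) (2 * m) (m + Suc r))"
      by (simp add: g_def mult_ac)
    also have "\<dots> \<simeq>\<^bsub>N\<^esub> (-1) ^ r * fps_X ^ (pent r + 4 * r + 2) * 1"
      by (intro agree_mult agree_refl 2)
    finally show "Q * g r \<simeq>\<^bsub>N\<^esub> (-1) ^ r * fps_X ^ (pent r + 4 * r + 2)" by simp
  next
    fix r assume r: "N \<le> r"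
    have "Q * f r = fps_X ^ pent r * (Q * (-1) ^ r * qbinomial (fps_X ^ 5) (2 * m) (m - r))"
      by (simp add: f_def mult_ac)
    also have "\<dots> \<simeq>\<^bsub>N\<^esub> 0"
      using r pent_ge[of r] by (intro X_power_agree_0) simp
    finally show "Q * f r \<simeq>\<^bsub>N\<^esub> 0" .
    have "Q * g r = fps_X ^ (pent r + 4 * r + 2)
        * (Q * (-1) ^ r * qbinomial (fps_X ^ 5) (2 * m) (m + Suc r))"
      by (simp add: g_def mult_ac)
    also have "\<dots> \<simeq>\<^bsub>N\<^esub> 0"
      using r pent_ge[of r] by (intro X_power_agree_0) simp
    finally show "Q * g r \<simeq>\<^bsub>N\<^esub> 0" .
  qed (simp_all add: m_def)
  also have "\<dots> = main_sum N 0"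
    by (simp add: main_sum_def main_term_def shifted_qfact_def power_add algebra_simps
        flip: sum_subtractf)
  finally show ?thesis unfolding Q_def m_def .
qed

lemma qfact_residues_mod_5:
  fixes x :: "'a::comm_ring_1"
  shows "qfact x (5 * m) = (\<Prod>t<m. (1 - x ^ (5 * t + 1)) * (1 - x ^ (5 * t + 4)))
     * (\<Prod>t<m. (1 - x ^ (5 * t + 3)) * (1 - x ^ (5 * t + 2))) * qfact (x ^ 5) m"
proof (induction m)
  case 0
  show ?case by (simp add: qfact_def)
next
  case (Suc m)
  have "qfact x (5 * Suc m) = qfact x (5 * m) * (1 - x ^ (5 * m + 1)) * (1 - x ^ (5 * m + 2))
      * (1 - x ^ (5 * m + 3)) * (1 - x ^ (5 * m + 4)) * (1 - x ^ (5 * m + 5))"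
  proof -
    have "5 * Suc m = Suc (Suc (Suc (Suc (Suc (5 * m)))))" by simp
    then show ?thesis by (simp only: qfact_Suc) (simp add: eval_nat_numeral)
  qed
  moreover have "x ^ (5 * m + 5) = (x ^ 5) ^ Suc m"
    unfolding power_mult[symmetric] by (rule arg_cong[where f = "power x"]) simp
  ultimately show ?case
    unfolding Suc.IH prod.lessThan_Suc qfact_Suc by (simp only: mult_ac)
qed

definition restricted_partitions :: "nat set \<Rightarrow> nat \<Rightarrow> nat \<Rightarrow> nat list set" where
  "restricted_partitions S m n = {xs \<in> partitions n. \<forall>x\<in>set xs. x \<in> S \<and> x \<le> m}"

lemma finite_restricted_partitions: "finite (restricted_partitions S m n)"
  by (simp add: restricted_partitions_def finite_partitions)

text \<open>
  A partition that contains the part \<open>Suc m\<close> has it in front. The other parts may equal \<open>Suc m\<close>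
  again, so the bound stays the same; this is the geometric series
  \<open>1 / (1 - x ^ Suc m)\<close>.
\<close>

lemma card_restricted_partitions_Suc:
  "card (restricted_partitions S (Suc m) n) = card (restricted_partitions S m n)
     + (if Suc m \<in> S \<and> Suc m \<le> n then card (restricted_partitions S (Suc m) (n - Suc m)) else 0)"
proof -
  define B where "B = (if Suc m \<in> S \<and> Suc m \<le> n
    then Cons (Suc m) ` restricted_partitions S (Suc m) (n - Suc m) else {})"
  have "restricted_partitions S (Suc m) n = restricted_partitions S m n \<union> B"
  proof (intro equalityI subsetI)
    fix xs assume xs: "xs \<in> restricted_partitions S (Suc m) n"
    show "xs \<in> restricted_partitions S m n \<union> B"
    proof (cases "Suc m \<in> set xs")
      case False
      have "x \<le> m" if "x \<in> set xs" for x
        using xs False that by (cases "x = Suc m") (auto simp: restricted_partitions_def)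
      then show ?thesis using xs by (auto simp: restricted_partitions_def)
    next
      case True
      then obtain y ys where y: "xs = y # ys" by (cases xs) auto
      have "y = Suc m"
        using xs True unfolding y
        by (auto simp: restricted_partitions_def partitions_def intro: antisym)
      then have "ys \<in> restricted_partitions S (Suc m) (n - Suc m)" "Suc m \<in> S" "Suc m \<le> n"
        using xs unfolding y by (auto simp: restricted_partitions_def partitions_def)
      then show ?thesis using y \<open>y = Suc m\<close> by (auto simp: B_def)
    qed
  next
    fix xs assume "xs \<in> restricted_partitions S m n \<union> B"
    then show "xs \<in> restricted_partitions S (Suc m) n"
      by (auto simp: restricted_partitions_def partitions_def B_def split: if_splits)
  qed
  moreover have "restricted_partitions S m n \<inter> B = {}"
  proof -
    have "Suc m \<in> set xs" if "xs \<in> B" for xs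
      using that by (auto simp: B_def split: if_splits)
    moreover have "Suc m \<notin> set xs" if "xs \<in> restricted_partitions S m n" for xs
      using that by (auto simp: restricted_partitions_def)
    ultimately show ?thesis by blast
  qed
  moreover have "finite B"
    by (auto simp: B_def finite_restricted_partitions)
  ultimately have "card (restricted_partitions S (Suc m) n) = card (restricted_partitions S m n) + card B"
    using finite_restricted_partitions[of S m n] by (simp add: card_Un_disjoint)
  moreover have "card (Cons (Suc m) ` A) = card A" for A
    by (rule card_image) simp
  ultimately show ?thesis by (simp add: B_def)
qed

definition restricted_gf :: "nat set \<Rightarrow> nat \<Rightarrow> real fps" where
  "restricted_gf S m = Abs_fps (\<lambda>n. real (card (restricted_partitions S m n)))"

lemma restricted_gf_Suc:
  "restricted_gf S (Suc m)
   = restricted_gf S m + (if Suc m \<in> S then fps_X ^ Suc m * restricted_gf S (Suc m) else 0)"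
  by (rule fps_ext)
    (simp add: restricted_gf_def fps_X_power_mult_nth card_restricted_partitions_Suc[of S m]
      del: power_Suc)

lemma restricted_gf_product:
  "(\<Prod>j<m. if Suc j \<in> S then 1 - fps_X ^ Suc j else 1) * restricted_gf S m = 1"
proof (induction m)
  case 0
  have "restricted_partitions S 0 n = (if n = 0 then {[]} else {})" for n
  proof -
    have "xs = []" if "xs \<in> restricted_partitions S 0 n" for xs
      using that by (cases xs) (auto simp: restricted_partitions_def partitions_def)
    moreover have "[] \<in> restricted_partitions S 0 n \<longleftrightarrow> n = 0"
      by (auto simp: restricted_partitions_def partitions_def)
    ultimately show ?thesis
      by (intro set_eqI) (metis empty_iff singleton_iff)
  qed
  then have "restricted_gf S 0 = 1"
    by (intro fps_ext) (simp add: restricted_gf_def)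
  then show ?case by simp
next
  case (Suc m)
  have "(if Suc m \<in> S then 1 - fps_X ^ Suc m else 1) * restricted_gf S (Suc m) = restricted_gf S m"
    using restricted_gf_Suc[of S m] by (simp add: algebra_simps split: if_splits)
  then show ?case using Suc by (simp only: prod.lessThan_Suc mult.assoc)
qed

section \<open>The first Rogers--Ramanujan identity\<close>

text \<open>
  Let \<open>A\<close>, \<open>B\<close> and \<open>C\<close> be the products of \<open>1 - x ^ j\<close> over \<open>j\<close> in the classes \<open>1, 4\<close>, in the
  classes \<open>2, 3\<close> and in the class \<open>0\<close> modulo 5. The series with difference condition, times
  \<open>A * B * C\<close>, is the theta series, which is \<open>B * C\<close>. The series of partitions into parts
  \<open>\<equiv> 1, 4\<close> is the inverse of \<open>A\<close>, so it has the same product with \<open>A * B * C\<close>, and the unit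
  cancels.
\<close>

theorem rogers_ramanujan_first:
  "card {xs \<in> partitions n. \<forall>x\<in>set xs. x mod 5 = 1 \<or> x mod 5 = 4}
   = card {xs \<in> partitions n. difference_at_least_2 xs}"
proof -
  define S where "S = {x :: nat. x mod 5 = 1 \<or> x mod 5 = 4}"
  define N where "N = Suc n"
  define m where "m = 2 * N"
  define A :: "real fps" where "A = (\<Prod>t<m. (1 - fps_X ^ (5 * t + 1)) * (1 - fps_X ^ (5 * t + 4)))"
  define B :: "real fps" where "B = (\<Prod>t<m. (1 - fps_X ^ (5 * t + 3)) * (1 - fps_X ^ (5 * t + 2)))"
  define C :: "real fps" where "C = qfact (fps_X ^ 5) m"
  have unit: "(A * B * C) dvd 1"
    by (simp add: A_def B_def C_def qfact_def fps_prod_nth_0)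
  have "A * B * C = qfact fps_X (5 * m)"
    unfolding A_def B_def C_def by (rule qfact_residues_mod_5[symmetric])
  then have "A * B * C * gap_gf 0 \<simeq>\<^bsub>N\<^esub> qfact fps_X N * gap_gf 0"
    using qfact_X_agree[of N "5 * m"] by (intro agree_mult agree_refl) (simp add: m_def)
  also have "\<dots> \<simeq>\<^bsub>N\<^esub> main_sum N 0"
    by (rule gap_gf_main_sum)
  also have "\<dots> \<simeq>\<^bsub>N\<^esub> qfact (fps_X ^ 5) N * B"
    unfolding B_def m_def by (rule agree_sym[OF triple_product_main_sum])
  also have "\<dots> \<simeq>\<^bsub>N\<^esub> C * B"
    unfolding C_def by (intro agree_mult agree_refl agree_sym[OF qfact_agree]) (simp_all add: m_def)
  also have "C * B = A * B * C * restricted_gf S (5 * m)"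
  proof -
    have "(\<Prod>j<5 * k. if Suc j \<in> S then 1 - fps_X ^ Suc j else 1)
        = (\<Prod>t<k. (1 - fps_X ^ (5 * t + 1)) * (1 - fps_X ^ (5 * t + 4)) :: real fps)" for k
    proof (induction k)
      case (Suc k)
      have "5 * Suc k = Suc (Suc (Suc (Suc (Suc (5 * k)))))" by simp
      moreover have "Suc (5 * k) \<in> S" "Suc (Suc (5 * k)) \<notin> S" "Suc (Suc (Suc (5 * k))) \<notin> S"
          "Suc (Suc (Suc (Suc (5 * k)))) \<in> S" "Suc (Suc (Suc (Suc (Suc (5 * k))))) \<notin> S"
        unfolding S_def by (simp_all add: mod_Suc)
      ultimately show ?case
        using Suc.IH by (simp only: prod.lessThan_Suc) (simp add: eval_nat_numeral mult_ac)
    qed simp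
    then have "A * restricted_gf S (5 * m) = 1"
      using restricted_gf_product[where S = S and m = "5 * m"] unfolding A_def by simp
    then show ?thesis by (metis mult.assoc mult.commute mult_1_right)
  qed
  finally have "gap_gf 0 \<simeq>\<^bsub>N\<^esub> restricted_gf S (5 * m)"
    by (rule agree_cancel_unit[OF unit])
  then have "fps_nth (gap_gf 0) n = fps_nth (restricted_gf S (5 * m)) n"
    by (rule agree_nth) (simp add: N_def)
  then have "card (restricted_partitions S (5 * m) n) = card (gap_partitions 0 n)"
    by (simp add: gap_gf_def restricted_gf_def)
  moreover have "restricted_partitions S (5 * m) n
      = {xs \<in> partitions n. \<forall>x\<in>set xs. x mod 5 = 1 \<or> x mod 5 = 4}"
  proof -
    have "x \<le> 5 * m" if "xs \<in> partitions n" "x \<in> set xs" for x xs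
      using that member_le_sum_list[of x xs] by (simp add: partitions_def m_def N_def)
    then show ?thesis by (auto simp: restricted_partitions_def S_def)
  qed
  ultimately show ?thesis by (simp add: gap_partitions_0_eq)
qed

section \<open>Prescribing the multiplicity of a part\<close>

lemma card_level_set:
  fixes f :: "'a \<Rightarrow> nat"
  assumes "finite A"
  shows "card {x \<in> A. f x = k} = card {x \<in> A. k \<le> f x} - card {x \<in> A. Suc k \<le> f x}"
proof -
  have "{x \<in> A. f x = k} = {x \<in> A. k \<le> f x} - {x \<in> A. Suc k \<le> f x}" by auto
  moreover have "{x \<in> A. Suc k \<le> f x} \<subseteq> {x \<in> A. k \<le> f x}" by auto
  ultimately show ?thesis using assms by (simp add: card_Diff_subset)
qed

text \<open>
  For lists, inserting copies of \<open>M\<close> requires a position; for multisets it is an addition.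
\<close>

lemma card_partitions_mset:
  "card {xs \<in> partitions n. P (mset xs)} = card {A. sum_mset A = n \<and> 0 \<notin># A \<and> P A}"
proof (rule bij_betw_same_card[of mset], rule bij_betw_byWitness[where f' = "\<lambda>A. rev (sorted_list_of_multiset A)"])
  show "\<forall>xs\<in>{xs \<in> partitions n. P (mset xs)}. rev (sorted_list_of_multiset (mset xs)) = xs"
  proof
    fix xs assume "xs \<in> {xs \<in> partitions n. P (mset xs)}"
    then have "sorted (rev xs)" by (simp add: partitions_def sorted_wrt_rev)
    then have "sort xs = rev xs" by (metis mset_rev properties_for_sort)
    then show "rev (sorted_list_of_multiset (mset xs)) = xs" by simp
  qed
  show "mset ` {xs \<in> partitions n. P (mset xs)} \<subseteq> {A. sum_mset A = n \<and> 0 \<notin># A \<and> P A}"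
    by (auto simp: partitions_def sum_mset_sum_list)
  show "(\<lambda>A. rev (sorted_list_of_multiset A)) ` {A. sum_mset A = n \<and> 0 \<notin># A \<and> P A}
      \<subseteq> {xs \<in> partitions n. P (mset xs)}"
  proof clarify
    fix A :: "nat multiset" assume A: "0 \<notin># A" "P A" "n = sum_mset A"
    have "sum_list (rev (sorted_list_of_multiset A)) = sum_mset A"
      by (metis mset_rev mset_sorted_list_of_multiset sum_mset_sum_list)
    then show "rev (sorted_list_of_multiset A) \<in> partitions (sum_mset A)
        \<and> P (mset (rev (sorted_list_of_multiset A)))"
      using A by (auto simp: partitions_def sorted_wrt_rev Suc_le_eq intro: gr0I)
  qed
qed simp

text \<open>
  Adding \<open>k\<close> copies of \<open>M\<close> is a bijection onto the partitions that contain \<open>M\<close> at least \<open>k\<close>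
  times.
\<close>

lemma card_partitions_multiplicity_ge:
  assumes "M \<in> S" and "M \<ge> 1"
  shows "card {xs \<in> {xs \<in> partitions n. \<forall>x\<in>set xs. x \<in> S}. k \<le> count_list xs M}
       = (if k * M \<le> n then card {xs \<in> partitions (n - k * M). \<forall>x\<in>set xs. x \<in> S} else 0)"
proof -
  let ?R = "replicate_mset k M"
  define L where "L = {A. sum_mset A = n \<and> 0 \<notin># A \<and> (set_mset A \<subseteq> S \<and> k \<le> count A M)}"
  define K where "K = {A. sum_mset A = n - k * M \<and> 0 \<notin># A \<and> set_mset A \<subseteq> S}"
  have L: "card {xs \<in> {xs \<in> partitions n. \<forall>x\<in>set xs. x \<in> S}. k \<le> count_list xs M} = card L"
    unfolding L_def card_partitions_mset[symmetric]
    by (rule arg_cong[where f = card]) (auto simp: count_mset)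
  have K: "card {xs \<in> partitions (n - k * M). \<forall>x\<in>set xs. x \<in> S} = card K"
    unfolding K_def card_partitions_mset[symmetric]
    by (rule arg_cong[where f = card]) auto
  have ex: "\<exists>B. A = B + ?R" if "A \<in> L" for A
    using that count_le_replicate_mset_subset_eq[of k A M] by (auto simp: L_def intro: subset_mset.diff_add[symmetric])
  show ?thesis
  proof (cases "k * M \<le> n")
    case True
    have "L = (\<lambda>B. B + ?R) ` K"
    proof (intro equalityI subsetI)
      fix A assume A: "A \<in> L"
      then obtain B where B: "A = B + ?R" using ex by blast
      then have "B \<in> K" using A by (auto simp: L_def K_def)
      then show "A \<in> (\<lambda>B. B + ?R) ` K" using B by blast
    next
      fix A assume "A \<in> (\<lambda>B. B + ?R) ` K"
      then show "A \<in> L" using True assms by (auto simp: L_def K_def split: if_splits)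
    qed
    then have "card L = card K" by (simp add: card_image inj_on_def)
    then show ?thesis using True L K by simp
  next
    case False
    have "L = {}"
    proof (rule ccontr)
      assume "L \<noteq> {}"
      then obtain A where A: "A \<in> L" by blast
      then obtain B where "A = B + ?R" using ex by blast
      then have "n = sum_mset B + k * M" using A by (simp add: L_def)
      then show False using False by simp
    qed
    then show ?thesis using False L by simp
  qed
qed

section \<open>Prescribing the leading gap\<close>

definition leading_gap_div :: "nat \<Rightarrow> nat list \<Rightarrow> nat" where
  "leading_gap_div M xs =
     (case xs of [] \<Rightarrow> 0 | x # ys \<Rightarrow> (case ys of [] \<Rightarrow> x div M | y # _ \<Rightarrow> (x - y - 2) div M))"

text \<open>
  Adding \<open>k * M\<close> to the largest part is a bijection from the partitions of \<open>n - k * M\<close>. The empty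
  partition is sent to the single part \<open>k * M\<close>. This part is positive because it
  occurs only for \<open>n = k * M\<close> and \<open>n \<ge> 1\<close>.
\<close>

lemma card_gap_partitions_leading_gap_ge:
  assumes "M \<ge> 1" and "n \<ge> 1"
  shows "card {xs \<in> gap_partitions 0 n. k \<le> leading_gap_div M xs}
       = (if k * M \<le> n then card (gap_partitions 0 (n - k * M)) else 0)"
proof -
  define L where "L = {xs \<in> gap_partitions 0 n. k \<le> leading_gap_div M xs}"
  have le: "k \<le> a div M \<longleftrightarrow> k * M \<le> a" for a
    using assms(1) by (simp add: less_eq_div_iff_mult_less_eq)
  show ?thesis
  proof (cases "k * M \<le> n")
    case True
    define h where "h xs = (case xs of [] \<Rightarrow> [k * M] | x # ys \<Rightarrow> (x + k * M) # ys)" for xs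
    define K where "K = gap_partitions 0 (n - k * M)"
    have "inj_on h K"
    proof (rule inj_onI)
      fix xs ys assume "xs \<in> K" "ys \<in> K" "h xs = h ys"
      then show "xs = ys"
        by (cases xs; cases ys) (auto simp: h_def K_def gap_partitions_def)
    qed
    moreover have "h ` K = L"
    proof (intro equalityI subsetI)
      fix xs assume "xs \<in> h ` K"
      then obtain ys where ys: "ys \<in> K" "xs = h ys" by blast
      show "xs \<in> L"
      proof (cases ys)
        case Nil
        then show ?thesis using ys True assms
          by (auto simp: L_def K_def h_def gap_partitions_def leading_gap_div_def le)
      next
        case (Cons y zs)
        then show ?thesis using ys True
          by (cases zs) (auto simp: L_def K_def h_def gap_partitions_def leading_gap_div_def le)
      qed
    next
      fix xs assume xs: "xs \<in> L"
      then obtain x ys where x: "xs = x # ys"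
        using assms(2) by (cases xs) (auto simp: L_def gap_partitions_def)
      show "xs \<in> h ` K"
      proof (cases "ys = [] \<and> x = k * M")
        case True
        then have "[] \<in> K" "xs = h []"
          using xs by (auto simp: x L_def K_def h_def gap_partitions_def)
        then show ?thesis by blast
      next
        case False
        have "(x - k * M) # ys \<in> K" "xs = h ((x - k * M) # ys)"
          using xs False
          by (cases ys; auto simp: x L_def K_def h_def gap_partitions_def leading_gap_div_def le)+
        then show ?thesis by blast
      qed
    qed
    ultimately have "card L = card K" using card_image by blast
    then show ?thesis using True by (simp add: L_def K_def)
  next
    case False
    have "L = {}"
    proof (rule ccontr)
      assume "L \<noteq> {}"
      then obtain xs where "xs \<in> L" by blast
      then show False using False assms
        by (auto simp: L_def gap_partitions_def leading_gap_div_def le split: list.splits)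
    qed
    then show ?thesis using False unfolding L_def[symmetric] by simp
  qed
qed

lemma leading_gap_div_floor:
  assumes "xs \<in> gap_partitions 0 n" and "n \<ge> 1"
  shows "leading_gap_div M xs = k \<longleftrightarrow>
      (length xs = 1 \<longrightarrow> \<lfloor>real n / real M\<rfloor> = int k) \<and>
      (length xs \<ge> 2 \<longrightarrow> \<lfloor>(real (xs ! 0) - real (xs ! 1) - 2) / real M\<rfloor> = int k)"
proof (cases xs)
  case Nil
  then show ?thesis using assms by (simp add: gap_partitions_def)
next
  case (Cons x ys)
  show ?thesis
  proof (cases ys)
    case Nil
    then show ?thesis
      using assms Cons by (simp add: gap_partitions_def leading_gap_div_def floor_divide_of_nat_eq)
  next
    case (Cons y zs)
    have "real x - real y - 2 = real (x - y - 2)"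
      using assms \<open>xs = x # ys\<close> Cons by (simp add: gap_partitions_def of_nat_diff)
    then show ?thesis
      using \<open>xs = x # ys\<close> Cons
      by (simp add: leading_gap_div_def floor_divide_of_nat_eq del: of_nat_diff)
  qed
qed

theorem theorem1p2:
  fixes M n k :: nat
  assumes "M \<ge> 1" and "M mod 5 = 1 \<or> M mod 5 = 4" and "n \<ge> 1"
  shows "card {xs \<in> partitions n. (\<forall>x\<in>set xs. x mod 5 = 1 \<or> x mod 5 = 4) \<and> count_list xs M = k}
       = card {xs \<in> partitions n. difference_at_least_2 xs \<and>
            (length xs = 1 \<longrightarrow> \<lfloor>real n / real M\<rfloor> = int k) \<and>
            (length xs \<ge> 2 \<longrightarrow> \<lfloor>(real (xs ! 0) - real (xs ! 1) - 2) / real M\<rfloor> = int k)}"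
proof -
  define S where "S = {x :: nat. x mod 5 = 1 \<or> x mod 5 = 4}"
  define L where "L = {xs \<in> partitions n. \<forall>x\<in>set xs. x \<in> S}"
  have RR: "card {xs \<in> partitions j. \<forall>x\<in>set xs. x \<in> S} = card (gap_partitions 0 j)" for j
    unfolding S_def gap_partitions_0_eq using rogers_ramanujan_first by simp
  have "finite L" by (simp add: L_def finite_partitions)
  have "M \<in> S" using assms by (simp add: S_def)
  have ge: "card {xs \<in> L. j \<le> count_list xs M} = card {xs \<in> gap_partitions 0 n. j \<le> leading_gap_div M xs}" for j
    unfolding L_def card_partitions_multiplicity_ge[OF \<open>M \<in> S\<close> assms(1)]
      card_gap_partitions_leading_gap_ge[OF assms(1,3)] RR ..
  have "card {xs \<in> partitions n. (\<forall>x\<in>set xs. x mod 5 = 1 \<or> x mod 5 = 4) \<and> count_list xs M = k}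
      = card {xs \<in> L. count_list xs M = k}"
    by (simp add: L_def S_def conj_assoc)
  also have "\<dots> = card {xs \<in> gap_partitions 0 n. leading_gap_div M xs = k}"
    by (simp only: card_level_set[OF \<open>finite L\<close>] card_level_set[OF finite_gap_partitions] ge)
  also have "{xs \<in> gap_partitions 0 n. leading_gap_div M xs = k}
      = {xs \<in> partitions n. difference_at_least_2 xs \<and>
            (length xs = 1 \<longrightarrow> \<lfloor>real n / real M\<rfloor> = int k) \<and>
            (length xs \<ge> 2 \<longrightarrow> \<lfloor>(real (xs ! 0) - real (xs ! 1) - 2) / real M\<rfloor> = int k)}"
    using leading_gap_div_floor[OF _ assms(3), of _ M k]
    unfolding gap_partitions_0_eq by blast
  finally show ?thesis .
qed

end
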